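(* Let $p>1$ and $\mu>0$. Let $F$ be a differentiable higher order strongly general convex function on the general convex set $K_g$ (with some positive constant). If the differential operator $F'(\cdot)$ is higher order strongly monotone in the sense that $$\langle F'(g(u))-F'(g(v)),\,g(u)-g(v)\rangle\ge 2\mu\,\|g(v)-g(u)\|^p\qquad\text{for all } g(u),g(v)\in K_g ,$$ then $$F(g(v))-F(g(u))\ge\langle F'(g(u)),\,g(v)-g(u)\rangle+\frac{2\mu}{p}\,\|g(v)-g(u)\|^p\qquad\text{for all } g(u),g(v)\in K_g .$$
   Context: $H$ is a real Hilbert space with inner product $\langle\cdot,\cdot\rangle$ and norm $\|\cdot\|$, and $g:H\to H$ is an arbitrary function. $K_g\subseteq H$ is a general convex set with respect to $g$: $g(u)+t(g(v)-g(u))\in K_g$ for all $u,v\in H$ with $g(u),g(v)\in K_g$ and all $t\in[0,1]$. As a standing assumption $g$ is onto $K_g$ (every point of $K_g$ is $g(v)$ for some $v\in H$). "For all $g(u),g(v)\in K_g$" means for all $u,v\in H$ with $g(u),g(v)\in K_g$. For $p>1$, a real-valued function $F$ on $K_g$ is higher order strongly general convex if there is a constant $c>0$ such that $$F\big(g(u)+t(g(v)-g(u))\big)\le(1-t)F(g(u))+tF(g(v))-c\,\{t^p(1-t)+t(1-t)^p\}\|g(v)-g(u)\|^p$$ for all $g(u),g(v)\in K_g$ and $t\in[0,1]$. "Differentiable" means Fréchet differentiable at the points of $K_g$ ($F$ being understood as defined near $K_g$), with $F'$ identified with an element of $H$. *)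

theory Defs
  imports "HOL-Analysis.Analysis"
begin

definition general_convex :: "('a::real_vector \<Rightarrow> 'a) \<Rightarrow> 'a set \<Rightarrow> bool" where
  "general_convex g K \<longleftrightarrow>
     (\<forall>u v. g u \<in> K \<longrightarrow> g v \<in> K \<longrightarrow>
        (\<forall>t\<in>{0..1}. g u + t *\<^sub>R (g v - g u) \<in> K))"

text \<open>Only the values of \<open>F\<close> on \<open>K\<close> matter when \<open>K\<close> is general convex with respect to \<open>g\<close>.
  The exponent is meant to satisfy \<open>p > 1\<close>; the convention \<open>0 powr p = 0\<close> then agrees
  with the usual value at the endpoints \<open>t = 0\<close>, \<open>t = 1\<close> and for \<open>g u = g v\<close>.\<close>

definition higher_order_strongly_general_convex ::
    "real \<Rightarrow> ('a::real_normed_vector \<Rightarrow> 'a) \<Rightarrow> 'a set \<Rightarrow> ('a \<Rightarrow> real) \<Rightarrow> bool" where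
  "higher_order_strongly_general_convex p g K F \<longleftrightarrow>
     (\<exists>c>0. \<forall>u v. g u \<in> K \<longrightarrow> g v \<in> K \<longrightarrow>
        (\<forall>t\<in>{0..1}. F (g u + t *\<^sub>R (g v - g u))
           \<le> (1 - t) * F (g u) + t * F (g v)
             - c * (t powr p * (1 - t) + t * (1 - t) powr p) * norm (g v - g u) powr p))"

end

theory Submission
  imports Defs
begin

text \<open>The bound is the integral of the monotonicity inequality along a segment.  Write
  \<open>x = g u\<close>, \<open>y = g v\<close> and \<open>d = y - x\<close>.  Monotonicity applied to \<open>x + t *\<^sub>R d\<close> and \<open>x\<close> says, after division by \<open>t\<close>, that
  the slope of \<open>F\<close> at \<open>x + t *\<^sub>R d\<close> in direction \<open>d\<close> exceeds the slope at \<open>x\<close> by at least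
  \<open>2 * \<mu> * t powr (p - 1) * norm d powr p\<close>.  Integrated over \<open>t\<close> from \<open>0\<close> to \<open>1\<close>, this excess
  contributes \<open>2 * \<mu> / p * norm d powr p\<close>.  The integration is carried out
  by the mean value theorem: subtracting the primitive of the lower bound from \<open>F\<close> leaves a
  function of \<open>t\<close> with nonnegative derivative.

  General convexity keeps the segment in \<open>K\<close>.  Surjectivity of \<open>g\<close> onto \<open>K\<close> names each of its
  points as some \<open>g w\<close>, so that the monotonicity hypothesis covers it.\<close>

lemma GDERIV_along_line:
  fixes x d :: "'a::real_inner"
  assumes "GDERIV F (x + t *\<^sub>R d) :> D"
  shows "((\<lambda>s. F (x + s *\<^sub>R d)) has_real_derivative D \<bullet> d) (at t)"
proof -
  have outer: "(F has_derivative (\<lambda>h. h \<bullet> D)) (at (x + t *\<^sub>R d))"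
    using assms by (simp add: gderiv_def)
  have inner: "((\<lambda>s. x + s *\<^sub>R d) has_derivative (\<lambda>s. s *\<^sub>R d)) (at t)"
    by (auto intro!: derivative_eq_intros)
  show ?thesis
    using has_derivative_compose[OF inner outer]
    by (simp add: has_field_derivative_def inner_commute mult_commute_abs)
qed

text \<open>The monotonicity hypothesis fixes \<open>x\<close> because what gets integrated is the growth of the slope
  since \<open>x\<close>.\<close>

lemma higher_order_gradient_inequality:
  fixes x y :: "'a::real_inner" and p \<mu> :: real
  assumes p: "p > 1"
    and grad: "\<And>z. z \<in> closed_segment x y \<Longrightarrow> GDERIV F z :> F' z"
    and mono: "\<And>z. z \<in> closed_segment x y \<Longrightarrow>
                 (F' z - F' x) \<bullet> (z - x) \<ge> 2 * \<mu> * norm (z - x) powr p"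
  shows "F y - F x \<ge> F' x \<bullet> (y - x) + (2 * \<mu> / p) * norm (y - x) powr p"
proof -
  define d where "d = y - x"
  define N where "N = norm d powr p"
  define \<phi> where "\<phi> t = F (x + t *\<^sub>R d) - t * (F' x \<bullet> d) - (2 * \<mu> / p) * N * t powr p" for t
  have seg: "x + t *\<^sub>R d \<in> closed_segment x y" if "0 \<le> t" "t \<le> 1" for t
    using that unfolding in_segment d_def
    by (intro exI[of _ t]) (simp add: algebra_simps)
  have line: "((\<lambda>s. F (x + s *\<^sub>R d)) has_real_derivative F' (x + t *\<^sub>R d) \<bullet> d) (at t)"
    if "0 \<le> t" "t \<le> 1" for t
    using GDERIV_along_line[OF grad[OF seg[OF that]]] .
  have slope: "F' (x + t *\<^sub>R d) \<bullet> d - F' x \<bullet> d \<ge> 2 * \<mu> * N * t powr (p - 1)"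
    if t: "0 < t" "t < 1" for t
  proof -
    have "2 * \<mu> * norm (t *\<^sub>R d) powr p \<le> (F' (x + t *\<^sub>R d) - F' x) \<bullet> (t *\<^sub>R d)"
      using mono[OF seg, of t] t by simp
    moreover have "norm (t *\<^sub>R d) powr p = t * (t powr (p - 1) * N)"
      using t by (simp add: N_def powr_mult powr_diff)
    ultimately have "t * (2 * \<mu> * N * t powr (p - 1)) \<le> t * (F' (x + t *\<^sub>R d) \<bullet> d - F' x \<bullet> d)"
      by (simp add: inner_diff_left mult_ac)
    then show ?thesis
      using t by simp
  qed
  have "\<phi> 0 \<le> \<phi> 1"
  proof (rule DERIV_nonneg_imp_increasing_open[of 0 1 \<phi>])
    \<comment> \<open>Derivatives are needed only in the open interval, where the power rule for \<open>t powr p\<close> and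
      the division by \<open>t\<close> are valid; continuity suffices at the endpoints.\<close>
    fix t :: real assume t: "0 < t" "t < 1"
    have "(\<phi> has_real_derivative
        F' (x + t *\<^sub>R d) \<bullet> d - F' x \<bullet> d - 2 * \<mu> * N * t powr (p - 1)) (at t)"
      unfolding \<phi>_def using t p line[of t]
      by (auto intro!: derivative_eq_intros simp: field_simps)
    then show "\<exists>D. (\<phi> has_real_derivative D) (at t) \<and> D \<ge> 0"
      using slope[OF t] by (intro exI conjI) auto
  next
    have "continuous_on {0..1} (\<lambda>t. F (x + t *\<^sub>R d))"
      using line by (intro continuous_at_imp_continuous_on ballI) (rule DERIV_isCont, auto)
    moreover have "continuous_on {0..1} (\<lambda>t::real. t powr p)"
      using p by (intro continuous_on_powr') (auto intro: continuous_intros)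
    ultimately show "continuous_on {0..1} \<phi>"
      unfolding \<phi>_def
      by (intro continuous_on_diff continuous_on_mult_left continuous_on_mult_right continuous_on_id)
  qed simp
  then show ?thesis
    by (simp add: \<phi>_def N_def d_def algebra_simps)
qed

theorem theorem16:
  fixes g :: "'a::{real_inner, complete_space} \<Rightarrow> 'a"
    and K :: "'a set"
    and F :: "'a \<Rightarrow> real"
    and F' :: "'a \<Rightarrow> 'a"
    and p \<mu> :: real
  assumes "p > 1" and "\<mu> > 0"
    and "general_convex g K"
    and "K \<subseteq> range g"
    and "higher_order_strongly_general_convex p g K F"
    and "\<And>x. x \<in> K \<Longrightarrow> GDERIV F x :> F' x"
    and "\<And>u v. g u \<in> K \<Longrightarrow> g v \<in> K \<Longrightarrow>
           (F' (g u) - F' (g v)) \<bullet> (g u - g v) \<ge> 2 * \<mu> * norm (g v - g u) powr p"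
  shows "\<forall>u v. g u \<in> K \<longrightarrow> g v \<in> K \<longrightarrow>
           F (g v) - F (g u) \<ge> F' (g u) \<bullet> (g v - g u) + (2 * \<mu> / p) * norm (g v - g u) powr p"
proof (intro allI impI)
  fix u v assume uv: "g u \<in> K" "g v \<in> K"
  have seg: "z \<in> K" if z: "z \<in> closed_segment (g u) (g v)" for z
  proof -
    obtain t where t: "0 \<le> t" "t \<le> 1" "z = (1 - t) *\<^sub>R g u + t *\<^sub>R g v"
      using z by (auto simp: in_segment)
    then have "z = g u + t *\<^sub>R (g v - g u)"
      by (simp add: algebra_simps)
    then show ?thesis
      using assms(3) uv t(1,2) by (auto simp: general_convex_def)
  qed
  show "F (g v) - F (g u) \<ge> F' (g u) \<bullet> (g v - g u) + (2 * \<mu> / p) * norm (g v - g u) powr p"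
  proof (rule higher_order_gradient_inequality[OF assms(1)])
    fix z assume z: "z \<in> closed_segment (g u) (g v)"
    show "GDERIV F z :> F' z"
      using assms(6) seg[OF z] .
    obtain w where "z = g w"
      using assms(4) seg[OF z] by auto
    then show "(F' z - F' (g u)) \<bullet> (z - g u) \<ge> 2 * \<mu> * norm (z - g u) powr p"
      using assms(7)[of w u] seg[OF z] uv(1) by (simp add: norm_minus_commute)
  qed
qed

end
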